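(* Let $c_1$ be a real number with $\frac57\le c_1\le 1$, and let $G\in\mathcal{G}$. Then $$\alpha(G)\ge c_1|V_1(G)|+\tfrac{3}{7}|V_2(G)|+(1-c_1)|V_3(G)|-\left(2c_1-\tfrac{8}{7}\right),$$ and this inequality holds with equality for every $G\in\mathcal{B}$. Moreover, if $c_1=\frac57$, then it also holds with equality for every $G\in\mathcal{A}$.
   Context: Graphs are finite, simple and undirected. $\mathcal{G}$ denotes the class of all connected graphs $G$ with maximum degree at most $3$, with $G\neq K_4$ and $|V(G)|\ge 3$. For $i\in\{1,2,3\}$, $V_i(G)=\{v\in V(G): d_G(v)=i\}$, where $d_G(v)$ is the degree of $v$. $\alpha(G)$ is the independence number of $G$. The class $\mathcal{A}$ is defined recursively: $K_3\in\mathcal{A}$; and if $G'\in\mathcal{A}$ and $x$ is a vertex of degree $2$ in $G'$, then the graph obtained from the disjoint union of $G'$ and a triangle $K_3$ by adding one edge between $x$ and a vertex of the triangle belongs to $\mathcal{A}$. The class $\mathcal{B}$ consists of all graphs obtained from a path $P_n$ on $n\ge 2$ vertices by attaching one pendant edge (to a new vertex) at every vertex of $P_n$. *)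

theory Defs
  imports Complex_Main "Graph_Theory.Graph_Theory"
begin

text \<open>
  A finite simple undirected graph is a \<^locale>\<open>pair_graph\<close>: a finite, loop-free, symmetric
  digraph whose arcs are pairs of vertices. Every edge is thus represented by two opposite arcs,
  so that the degree of a vertex in the undirected sense is its out-degree.
\<close>

type_synonym 'a ugraph = "'a pair_pre_digraph"

abbreviation degree :: "'a ugraph \<Rightarrow> 'a \<Rightarrow> nat" where
  "degree G v \<equiv> out_degree (with_proj G) v"

definition deg_verts :: "nat \<Rightarrow> 'a ugraph \<Rightarrow> 'a set" where
  "deg_verts i G = {v \<in> pverts G. degree G v = i}"

definition independent_set :: "'a ugraph \<Rightarrow> 'a set \<Rightarrow> bool" where
  "independent_set G S \<longleftrightarrow> S \<subseteq> pverts G \<and> (\<forall>u \<in> S. \<forall>v \<in> S. (u, v) \<notin> parcs G)"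

definition independence_number :: "'a ugraph \<Rightarrow> nat" where
  "independence_number G = Max (card ` {S. independent_set G S})"

text \<open>
  \<open>Digraph_Component.connected\<close> is qualified because \<open>Complex_Main\<close> also has topological
  connectedness.
\<close>

definition class_G :: "'a ugraph set" where
  "class_G = {G. pair_graph G \<and> Digraph_Component.connected (with_proj G) \<and>
     (\<forall>v \<in> pverts G. degree G v \<le> 3) \<and> \<not> K\<^bsub>4\<^esub> (with_proj G) \<and> card (pverts G) \<ge> 3}"

text \<open>
  The predicate \<open>K\<^bsub>n\<^esub>\<close> says that a graph is complete on \<open>n\<close> vertices, whatever these are. Since
  the triangle \<open>T\<close> ranges over all triangles disjoint from \<open>G\<close>, the class below is closed
  under isomorphism.
\<close>

inductive_set class_A :: "'a ugraph set" where
  triangle: "K\<^bsub>3\<^esub> (with_proj T) \<Longrightarrow> T \<in> class_A"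
| attach: "\<lbrakk>G \<in> class_A; x \<in> pverts G; degree G x = 2;
            K\<^bsub>3\<^esub> (with_proj T); pverts T \<inter> pverts G = {}; y \<in> pverts T\<rbrakk>
    \<Longrightarrow> \<lparr>pverts = pverts G \<union> pverts T,
          parcs = parcs G \<union> parcs T \<union> {(x, y), (y, x)}\<rparr> \<in> class_A"

text \<open>The path visiting the vertices of a list \<open>p\<close> (assumed distinct) in order.\<close>

definition path_graph :: "'a list \<Rightarrow> 'a ugraph" where
  "path_graph p = \<lparr>pverts = set p, parcs = symcl {(p ! i, p ! Suc i) |i. Suc i < length p}\<rparr>"

text \<open>
  For every vertex \<open>v\<close> of \<open>G\<close>, add the vertex \<open>f v\<close> and the edge joining it to \<open>v\<close>. The new
  vertices are pairwise distinct and not in \<open>G\<close> if \<open>f\<close> is injective on the vertices of \<open>G\<close> and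
  its values are not vertices of \<open>G\<close>.
\<close>

definition attach_pendants :: "('a \<Rightarrow> 'a) \<Rightarrow> 'a ugraph \<Rightarrow> 'a ugraph" where
  "attach_pendants f G =
     \<lparr>pverts = pverts G \<union> f ` pverts G,
      parcs = parcs G \<union> symcl {(v, f v) |v. v \<in> pverts G}\<rparr>"

definition class_B :: "'a ugraph set" where
  "class_B = {attach_pendants f (path_graph p) |f p.
     length p \<ge> 2 \<and> distinct p \<and> inj_on f (set p) \<and> f ` set p \<inter> set p = {}}"

end

theory Submission
  imports Defs
begin

text \<open>
  Put \<open>t = 7 * c1 - 4\<close>, so that \<open>t \<ge> 1\<close>. The lower bound is proved for all connected
  induced subgraphs by induction on the number of vertices: choose a vertex \<open>v\<close>, delete its
  closed neighbourhood \<open>S\<close>, and add \<open>v\<close> to the union of independent sets of the remaining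
  components \<open>C\<close>. If \<open>e C\<close> is the number of edges between \<open>C\<close> and \<open>S\<close>, the induction goes
  through as soon as the weight of \<open>S\<close> is at most \<open>7 + 2 * t + t * (\<Sum>C. e C - 2)\<close>. The danger
  are thus components attached by a single edge. A leaf always satisfies the inequality. If there
  is no leaf, take a smallest nonempty set \<open>X\<close> with at most one outgoing edge. By minimality,
  deleting a closed neighbourhood contained in \<open>X\<close> leaves at most one component attached by a
  single edge, and this is good enough both when \<open>v\<close> has degree 2 and when all vertices of
  \<open>X\<close> have degree 3; one of the two can always be arranged.
\<close>

section \<open>Vertex weights\<close>

text \<open>
  The weights are 7 times the coefficients of the bound, with \<open>t = 7 * c1 - 4\<close>. The value at
  degree 0 makes the bound tight for a single vertex, so that it also applies to one-vertex
  components arising in the induction.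
\<close>

definition weight :: "real \<Rightarrow> nat \<Rightarrow> real" where
  "weight t d = (if d = 0 then 7 + 2 * t else if d = 1 then 4 + t else if d = 2 then 3 else 3 - t)"

text \<open>From degree 0 up to degree 3 the weight drops successively by \<open>3 + t\<close>,
  \<open>1 + t\<close> and \<open>t\<close>, so each additional edge costs at least
  \<open>t\<close>.\<close>

lemma weight_add:
  assumes "1 \<le> t" "d + j \<le> 3"
  shows "weight t (d + j) + t * real j \<le> weight t d"
proof -
  have "j = 0 \<or> j = 1 \<or> j = 2 \<or> j = 3" "d = 0 \<or> d = 1 \<or> d = 2 \<or> d = 3"
    using assms(2) by auto
  then show ?thesis
    using assms by (elim disjE) (auto simp: weight_def)
qed

text \<open>The drop from degree 1 to degree 2 exceeds \<open>t\<close> by 1.\<close>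

lemma weight_add_leaf:
  assumes "1 \<le> t" "1 \<le> j" "1 + j \<le> 3"
  shows "weight t (1 + j) + t * real j + 1 \<le> weight t 1"
proof -
  have "j = 1 \<or> j = 2"
    using assms by auto
  then show ?thesis
    using assms by (elim disjE) (auto simp: weight_def)
qed

text \<open>Here \<open>e C\<close> is meant as the number of edges joining a component to the
  deleted set. Terms with \<open>e C \<ge> 2\<close> are nonpositive, and a term with
  \<open>e C = 1\<close> equals \<open>t\<close> and occurs at most once. If it occurs and the total
  is at most 2, there is no room for a second component, so the total is 1, which is odd.\<close>

lemma sum_deficit_le:
  assumes "finite \<C>" "0 \<le> t" "\<And>C. C \<in> \<C> \<Longrightarrow> 1 \<le> e C"
    and unique: "\<And>C D. C \<in> \<C> \<Longrightarrow> D \<in> \<C> \<Longrightarrow> e C \<le> 1 \<Longrightarrow> e D \<le> 1 \<Longrightarrow> C = D"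
  shows "(\<Sum>C\<in>\<C>. 2 * t - t * real (e C)) \<le> t"
    and "even (\<Sum>C\<in>\<C>. e C) \<Longrightarrow> (\<Sum>C\<in>\<C>. e C) \<le> 2 \<Longrightarrow> (\<Sum>C\<in>\<C>. 2 * t - t * real (e C)) \<le> 0"
proof -
  have le0: "(\<Sum>C\<in>\<D>. 2 * t - t * real (e C)) \<le> 0" if "\<And>C. C \<in> \<D> \<Longrightarrow> 2 \<le> e C" for \<D>
  proof (rule sum_nonpos)
    fix C assume "C \<in> \<D>"
    then have "t * 2 \<le> t * real (e C)"
      using that assms(2) by (intro mult_left_mono) auto
    then show "2 * t - t * real (e C) \<le> 0"
      by simp
  qed
  have "(\<Sum>C\<in>\<C>. 2 * t - t * real (e C)) \<le> t \<and>
    (even (\<Sum>C\<in>\<C>. e C) \<longrightarrow> (\<Sum>C\<in>\<C>. e C) \<le> 2 \<longrightarrow> (\<Sum>C\<in>\<C>. 2 * t - t * real (e C)) \<le> 0)"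
  proof (cases "\<exists>C\<in>\<C>. e C \<le> 1")
    case False
    then have "2 \<le> e C" if "C \<in> \<C>" for C
      using that by force
    then show ?thesis
      using le0[of \<C>] assms(2) by auto
  next
    case True
    then obtain C where C: "C \<in> \<C>" "e C \<le> 1"
      by blast
    then have eC: "e C = 1"
      using assms(3)[of C] by auto
    have ge2: "2 \<le> e D" if "D \<in> \<C> - {C}" for D
      using unique[OF C(1), of D] C that by force
    have "odd (\<Sum>D\<in>\<C>. e D)" if "(\<Sum>D\<in>\<C>. e D) \<le> 2"
    proof -
      have "(\<Sum>D\<in>\<C> - {C}. e D) \<le> 1"
        using that eC sum.remove[OF assms(1) C(1), of e] by simp
      moreover have "e D \<le> (\<Sum>D\<in>\<C> - {C}. e D)" if "D \<in> \<C> - {C}" for D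
        using that assms(1) by (intro member_le_sum) auto
      ultimately have "\<C> - {C} = {}"
        using ge2 by fastforce
      then have "(\<Sum>D\<in>\<C> - {C}. e D) = 0"
        by (simp only: sum.empty)
      then show ?thesis
        using eC sum.remove[OF assms(1) C(1), of e] by simp
    qed
    moreover have "(\<Sum>D\<in>\<C>. 2 * t - t * real (e D)) \<le> t"
      using le0[of "\<C> - {C}"] ge2 eC sum.remove[OF assms(1) C(1), of "\<lambda>C. 2 * t - t * real (e C)"]
      by simp
    ultimately show ?thesis
      by blast
  qed
  then show "(\<Sum>C\<in>\<C>. 2 * t - t * real (e C)) \<le> t"
    and "even (\<Sum>C\<in>\<C>. e C) \<Longrightarrow> (\<Sum>C\<in>\<C>. e C) \<le> 2 \<Longrightarrow> (\<Sum>C\<in>\<C>. 2 * t - t * real (e C)) \<le> 0"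
    by auto
qed

section \<open>Connected induced subgraphs and their components\<close>

locale edge_relation =
  fixes E :: "'a rel"
  assumes E_sym: "(u, v) \<in> E \<Longrightarrow> (v, u) \<in> E"
    and E_irrefl: "(v, v) \<notin> E"
begin

definition nbrs :: "'a set \<Rightarrow> 'a \<Rightarrow> 'a set" where
  "nbrs U v = {u \<in> U. (v, u) \<in> E}"

definition deg :: "'a set \<Rightarrow> 'a \<Rightarrow> nat" where
  "deg U v = card (nbrs U v)"

text \<open>Ordered pairs are counted, which gives every edge exactly once when \<open>A\<close> and
  \<open>B\<close> are disjoint.\<close>

definition edges :: "'a set \<Rightarrow> 'a set \<Rightarrow> nat" where
  "edges A B = card (E \<inter> A \<times> B)"

definition indep :: "'a set \<Rightarrow> bool" where
  "indep S \<longleftrightarrow> (\<forall>u \<in> S. \<forall>v \<in> S. (u, v) \<notin> E)"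

text \<open>
  Connectedness of the subgraph induced by \<open>U\<close>, phrased by cuts because the proof only ever
  uses an edge leaving a proper nonempty subset.
\<close>

definition conn :: "'a set \<Rightarrow> bool" where
  "conn U \<longleftrightarrow> U \<noteq> {} \<and>
     (\<forall>A. A \<subset> U \<longrightarrow> A \<noteq> {} \<longrightarrow> (\<exists>x \<in> A. \<exists>y \<in> U - A. (x, y) \<in> E))"

text \<open>
  The correction term is needed because the bound fails by 1/7 for a single edge, the only
  connected graph with this defect.
\<close>

definition potential :: "real \<Rightarrow> 'a set \<Rightarrow> real" where
  "potential t U = (\<Sum>v\<in>U. weight t (deg U v)) - 2 * t - of_bool (card U = 2)"

text \<open>Maximality of the components is expressed by the absence of edges between them. The
  empty set is never a component because \<open>conn\<close> excludes it.\<close>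

definition components_of :: "'a set \<Rightarrow> 'a set set \<Rightarrow> bool" where
  "components_of W \<C> \<longleftrightarrow> \<Union>\<C> = W \<and> (\<forall>C \<in> \<C>. conn C) \<and>
     (\<forall>C \<in> \<C>. \<forall>D \<in> \<C>. C \<noteq> D \<longrightarrow> C \<inter> D = {} \<and> E \<inter> C \<times> D = {})"

lemma nbrs_iff: "u \<in> nbrs U v \<longleftrightarrow> u \<in> U \<and> (v, u) \<in> E"
  by (simp add: nbrs_def)

lemma connD:
  assumes "conn U" "A \<subset> U" "A \<noteq> {}"
  obtains x y where "x \<in> A" "y \<in> U - A" "(x, y) \<in> E"
  using assms unfolding conn_def by blast

lemma edges_sym: "edges A B = edges B A"
proof -
  have "E \<inter> B \<times> A = prod.swap ` (E \<inter> A \<times> B)"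
    by (auto simp: pair_in_swap_image intro: E_sym)
  then show ?thesis
    by (simp add: edges_def card_image)
qed

lemma edges_eq_sum_deg:
  assumes "finite A" "finite B"
  shows "edges A B = (\<Sum>a\<in>A. deg B a)"
proof -
  have "E \<inter> A \<times> B = Sigma A (nbrs B)"
    by (auto simp: nbrs_def)
  then show ?thesis
    using assms by (simp add: edges_def deg_def nbrs_def)
qed

lemma edges_pos:
  assumes "finite A" "finite B" "x \<in> A" "y \<in> B" "(x, y) \<in> E"
  shows "1 \<le> edges A B"
proof -
  have "E \<inter> A \<times> B \<noteq> {}" "finite (E \<inter> A \<times> B)"
    using assms by auto
  then show ?thesis
    by (simp add: edges_def Suc_le_eq card_gt_0_iff)
qed

lemma edges_le_1_unique:
  assumes "finite A" "finite B" "edges A B \<le> 1"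
    and "(x, y) \<in> E \<inter> A \<times> B" "(x', y') \<in> E \<inter> A \<times> B"
  shows "x = x'" "y = y'"
proof -
  have "finite (E \<inter> A \<times> B)"
    using assms by auto
  then have "(x, y) = (x', y')"
    using assms(3,4,5) unfolding edges_def by (metis One_nat_def card_le_Suc0_iff_eq)
  then show "x = x'" "y = y'"
    by auto
qed

lemma deg_Un:
  assumes "finite A" "finite B" "A \<inter> B = {}"
  shows "deg (A \<union> B) v = deg A v + deg B v"
proof -
  have "nbrs (A \<union> B) v = nbrs A v \<union> nbrs B v" "nbrs A v \<inter> nbrs B v = {}"
    using assms(3) by (auto simp: nbrs_def)
  moreover have "finite (nbrs A v)" "finite (nbrs B v)"
    using assms by (auto simp: nbrs_def)
  ultimately show ?thesis
    by (simp add: deg_def card_Un_disjoint)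
qed

text \<open>A smallest nonempty \<open>C\<close> without edges to the rest of \<open>W\<close> is
  connected: a proper part of \<open>C\<close> without edges to the rest of \<open>C\<close> would
  be a smaller such set. Induction splits \<open>W - C\<close>.\<close>

lemma ex_components_of:
  assumes "finite W"
  shows "\<exists>\<C>. components_of W \<C>"
  using assms
proof (induction "card W" arbitrary: W rule: less_induct)
  case less
  show ?case
  proof (cases "W = {}")
    case True
    then show ?thesis
      by (auto simp: components_of_def intro: exI[of _ "{}"])
  next
    case False
    define P where "P C \<longleftrightarrow> C \<subseteq> W \<and> C \<noteq> {} \<and> E \<inter> C \<times> (W - C) = {}" for C
    have "P W"
      using False by (auto simp: P_def)
    then obtain C where C: "P C" and min: "\<And>D. P D \<Longrightarrow> card C \<le> card D"
      using ex_has_least_nat[of P W card] by blast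
    have CW: "C \<subseteq> W" "C \<noteq> {}" "E \<inter> C \<times> (W - C) = {}"
      using C by (auto simp: P_def)
    have finC: "finite C"
      using CW(1) less.prems by (rule finite_subset)
    have "\<exists>x\<in>A. \<exists>y\<in>C - A. (x, y) \<in> E" if A: "A \<subset> C" "A \<noteq> {}" for A
    proof (rule ccontr)
      assume "\<not> ?thesis"
      then have "P A"
        using A CW unfolding P_def by blast
      with min[of A] psubset_card_mono[OF finC A(1)] show False
        by simp
    qed
    then have connC: "conn C"
      using CW by (auto simp: conn_def)
    have "card (W - C) < card W"
      using CW less.prems by (intro psubset_card_mono) auto
    then obtain \<D> where \<D>: "components_of (W - C) \<D>"
      using less by blast
    have "components_of W (insert C \<D>)"
      unfolding components_of_def
    proof (intro conjI ballI impI)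
      show "\<Union> (insert C \<D>) = W"
        using \<D> CW by (auto simp: components_of_def)
    next
      fix D assume "D \<in> insert C \<D>"
      then show "conn D"
        using \<D> connC by (auto simp: components_of_def)
    next
      fix D D' assume D: "D \<in> insert C \<D>" "D' \<in> insert C \<D>" "D \<noteq> D'"
      have *: "F \<subseteq> W - C" if "F \<in> \<D>" for F
        using \<D> that by (auto simp: components_of_def)
      show "D \<inter> D' = {}"
        using D * \<D> unfolding components_of_def by blast
      show "E \<inter> D \<times> D' = {}"
      proof (cases "D = C \<or> D' = C")
        case True
        then have "D = C \<and> D' \<subseteq> W - C \<or> D' = C \<and> D \<subseteq> W - C"
          using D * by blast
        then show ?thesis
          using CW(3) E_sym by blast
      next
        case False
        then show ?thesis
          using D \<D> unfolding components_of_def by blast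
      qed
    qed
    then show ?thesis ..
  qed
qed

text \<open>
  Each edge to the deleted set \<open>S\<close> gains at least \<open>t\<close>; in a single-edge component it
  gains one more, which pays for the correction term of \<^const>\<open>potential\<close>.
\<close>

lemma potential_component_ge:
  assumes "1 \<le> t" "conn C" "finite C" "finite S" "1 \<le> edges C S"
    and deg3: "\<And>x. x \<in> C \<Longrightarrow> deg C x + deg S x \<le> 3"
  shows "(\<Sum>x\<in>C. weight t (deg C x + deg S x)) + t * edges C S - 2 * t \<le> potential t C"
proof -
  have gain: "weight t (deg C x + deg S x) + t * deg S x \<le> weight t (deg C x)" if "x \<in> C" for x
    using weight_add[OF assms(1) deg3[OF that]] .
  have eq: "t * edges C S = (\<Sum>x\<in>C. t * deg S x)"
    by (simp add: edges_eq_sum_deg assms sum_distrib_left)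
  show ?thesis
  proof (cases "card C = 2")
    case False
    have "(\<Sum>x\<in>C. weight t (deg C x + deg S x) + t * deg S x) \<le> (\<Sum>x\<in>C. weight t (deg C x))"
      by (rule sum_mono) (rule gain)
    then show ?thesis
      using False by (simp add: eq potential_def sum.distrib)
  next
    case True
    then obtain a b where ab: "C = {a, b}" "a \<noteq> b"
      by (auto simp: card_2_iff)
    obtain x y where "x \<in> {a}" "y \<in> C - {a}" "(x, y) \<in> E"
      using connD[OF assms(2), of "{a}"] ab by blast
    then have "(a, b) \<in> E" "(b, a) \<in> E"
      using ab E_sym by auto
    then have "nbrs C a = {b}" "nbrs C b = {a}"
      using ab E_irrefl by (auto simp: nbrs_def)
    then have d1: "deg C a = 1" "deg C b = 1"
      by (auto simp: deg_def)
    have e: "edges C S = deg S a + deg S b"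
      using ab by (simp add: edges_eq_sum_deg assms)
    then have "1 \<le> deg S a \<or> 1 \<le> deg S b"
      using assms(5) by linarith
    \<comment> \<open>At least one end of the edge also has a neighbour in \<open>S\<close>, and
      \<open>weight_add_leaf\<close> supplies the extra 1 there.\<close>
    then have "weight t (1 + deg S a) + t * deg S a + (weight t (1 + deg S b) + t * deg S b) + 1
        \<le> weight t 1 + weight t 1"
      using gain[of a] gain[of b] deg3[of a] deg3[of b] d1 ab
        weight_add_leaf[OF assms(1), of "deg S a"] weight_add_leaf[OF assms(1), of "deg S b"]
      by force
    then show ?thesis
      using ab d1 True by (simp add: e[unfolded ab(1)] potential_def algebra_simps)
  qed
qed

section \<open>Degrees, edges and sums over the components of \<open>U - S\<close>\<close>

lemma deg_mono:
  assumes "finite B" "A \<subseteq> B"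
  shows "deg A v \<le> deg B v"
  unfolding deg_def using assms by (intro card_mono) (auto simp: nbrs_def)

lemma component_subset: "components_of W \<C> \<Longrightarrow> C \<in> \<C> \<Longrightarrow> C \<subseteq> W"
  by (auto simp: components_of_def)

lemma component_conn: "components_of W \<C> \<Longrightarrow> C \<in> \<C> \<Longrightarrow> conn C"
  by (simp add: components_of_def)

lemma component_disjoint:
  "components_of W \<C> \<Longrightarrow> C \<in> \<C> \<Longrightarrow> D \<in> \<C> \<Longrightarrow> C \<noteq> D \<Longrightarrow> C \<inter> D = {}"
  by (simp add: components_of_def)

lemma component_no_edge:
  assumes "components_of W \<C>" "C \<in> \<C>" "D \<in> \<C>" "C \<noteq> D" "x \<in> C" "y \<in> D"
  shows "(x, y) \<notin> E"
proof -
  have "E \<inter> C \<times> D = {}"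
    using assms by (simp add: components_of_def)
  then show ?thesis
    using assms by auto
qed

lemma neighbour_of_component:
  assumes "components_of (U - S) \<C>" "C \<in> \<C>" "x \<in> C" "(x, y) \<in> E" "y \<in> U" "y \<notin> S"
  shows "y \<in> C"
proof -
  have "y \<in> \<Union>\<C>"
    using assms by (simp add: components_of_def)
  then obtain D where "D \<in> \<C>" "y \<in> D"
    by auto
  then show ?thesis
    using component_no_edge[OF assms(1,2), of D x y] assms(3,4) by auto
qed

text \<open>No edge joins two components, so all neighbours of \<open>x\<close> in \<open>U\<close>
  lie in \<open>C\<close> or in \<open>S\<close>.\<close>

lemma deg_component:
  assumes "finite U" "S \<subseteq> U" "components_of (U - S) \<C>" "C \<in> \<C>" "x \<in> C"
  shows "deg U x = deg C x + deg S x"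
proof -
  have C: "C \<subseteq> U - S"
    using assms component_subset by blast
  have "u \<in> C \<union> S" if "u \<in> U" "(x, u) \<in> E" for u
    using that assms neighbour_of_component by blast
  then have "nbrs U x = nbrs (C \<union> S) x"
    using C assms(2) by (auto simp: nbrs_def)
  moreover have "finite C" "finite S"
    using C assms by (auto intro: finite_subset)
  ultimately show ?thesis
    using deg_Un[of C S x] C by (auto simp: deg_def)
qed

text \<open>Connectedness of \<open>U\<close> provides an edge leaving \<open>C\<close>, and such an
  edge can only end in \<open>S\<close>.\<close>

lemma component_edges_pos:
  assumes "finite U" "conn U" "S \<subseteq> U" "S \<noteq> {}" "components_of (U - S) \<C>" "C \<in> \<C>"
  shows "1 \<le> edges C S"
proof -
  have C: "C \<subseteq> U - S" "C \<noteq> {}"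
    using component_subset[OF assms(5,6)] component_conn[OF assms(5,6)] by (auto simp: conn_def)
  then have "C \<subset> U"
    using assms(3,4) by blast
  then obtain x y where xy: "x \<in> C" "y \<in> U - C" "(x, y) \<in> E"
    using connD[OF assms(2)] C(2) by metis
  then have "y \<in> S"
    using neighbour_of_component[OF assms(5,6)] by blast
  moreover have "finite C" "finite S"
    using C assms by (auto intro: finite_subset)
  ultimately show ?thesis
    using edges_pos xy by blast
qed

lemma finite_components_of:
  assumes "finite W" "components_of W \<C>"
  shows "finite \<C>"
  using assms finite_UnionD unfolding components_of_def by blast

lemma sum_components_of:
  assumes "finite W" "components_of W \<C>"
  shows "sum f W = (\<Sum>C\<in>\<C>. sum f C)"
proof -
  have W: "W = \<Union>\<C>"
    using assms by (auto simp: components_of_def)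
  show ?thesis
    unfolding W using assms
    by (subst sum.Union_disjoint) (auto simp: components_of_def intro: finite_subset)
qed

lemma sum_component_edges:
  assumes "finite U" "S \<subseteq> U" "components_of (U - S) \<C>"
  shows "(\<Sum>C\<in>\<C>. edges C S) = edges S (U - S)"
proof -
  have fin: "finite S" "finite (U - S)"
    using assms by (auto intro: finite_subset)
  have "(\<Sum>C\<in>\<C>. edges C S) = (\<Sum>C\<in>\<C>. \<Sum>x\<in>C. deg S x)"
    using fin component_subset[OF assms(3)]
    by (intro sum.cong refl edges_eq_sum_deg) (auto intro: finite_subset)
  also have "\<dots> = edges (U - S) S"
    using sum_components_of[OF fin(2) assms(3), of "deg S"] fin by (simp add: edges_eq_sum_deg)
  finally show ?thesis
    using edges_sym by simp
qed

section \<open>The lower bound\<close>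

text \<open>The inductive step. The vertex \<open>v\<close> together with the sets obtained for the
  components is independent and gains 7 for \<open>v\<close>. By
  \<open>potential_component_ge\<close>, the weight of a component \<open>C\<close> inside
  \<open>U\<close> exceeds its own potential by at most \<open>2 * t - t * edges C S\<close>. On the
  right of \<open>loss\<close>, 7 comes from \<open>v\<close>, and the other two terms are those
  subtracted in \<open>potential t U\<close>.\<close>

lemma ex_indep_reduction:
  assumes t: "1 \<le> t" and U: "finite U" "conn U" "\<And>x. x \<in> U \<Longrightarrow> deg U x \<le> 3"
    and IH: "\<And>C. C \<subset> U \<Longrightarrow> conn C \<Longrightarrow> \<exists>I\<subseteq>C. indep I \<and> potential t C \<le> 7 * real (card I)"
    and v: "v \<in> U" and S: "S = insert v (nbrs U v)" and \<C>: "components_of (U - S) \<C>"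
    and loss: "(\<Sum>s\<in>S. weight t (deg U s)) + (\<Sum>C\<in>\<C>. 2 * t - t * edges C S)
      \<le> 7 + 2 * t + of_bool (card U = 2)"
  shows "\<exists>I\<subseteq>U. indep I \<and> potential t U \<le> 7 * real (card I)"
proof -
  have SU: "S \<subseteq> U" "S \<noteq> {}"
    using v by (auto simp: S nbrs_def)
  have CU: "C \<subseteq> U - S" if "C \<in> \<C>" for C
    using component_subset[OF \<C> that] .
  have finC: "finite C" if "C \<in> \<C>" for C
    using CU[OF that] U by (auto intro: finite_subset)
  have fin: "finite S" "finite (U - S)"
    using SU U by (auto intro: finite_subset)
  have fin\<C>: "finite \<C>"
    using finite_components_of[OF fin(2) \<C>] .
  have "\<exists>I\<subseteq>C. indep I \<and> potential t C \<le> 7 * real (card I)" if "C \<in> \<C>" for C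
  proof (rule IH)
    show "C \<subset> U"
      using CU[OF that] SU by blast
    show "conn C"
      using \<C> that by (simp add: components_of_def)
  qed
  then obtain J where J: "\<And>C. C \<in> \<C> \<Longrightarrow> J C \<subseteq> C" "\<And>C. C \<in> \<C> \<Longrightarrow> indep (J C)"
      "\<And>C. C \<in> \<C> \<Longrightarrow> potential t C \<le> 7 * real (card (J C))"
    by metis
  define I where "I = insert v (\<Union>C\<in>\<C>. J C)"
  have JS: "(\<Union>C\<in>\<C>. J C) \<subseteq> U - S"
    using J CU by blast
  then have "v \<notin> (\<Union>C\<in>\<C>. J C)"
    by (auto simp: S)
  moreover have "finite (\<Union>C\<in>\<C>. J C)"
    using JS fin(2) by (rule finite_subset)
  moreover have "card (\<Union>C\<in>\<C>. J C) = (\<Sum>C\<in>\<C>. card (J C))"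
  proof (rule card_UN_disjoint)
    show "\<forall>C\<in>\<C>. finite (J C)"
      using J finC by (meson finite_subset)
    show "\<forall>C\<in>\<C>. \<forall>D\<in>\<C>. C \<noteq> D \<longrightarrow> J C \<inter> J D = {}"
      using J(1) component_disjoint[OF \<C>] by blast
  qed (rule fin\<C>)
  ultimately have cardI: "card I = 1 + (\<Sum>C\<in>\<C>. card (J C))"
    by (simp add: I_def)
  have "indep I"
  proof -
    have no: "(x, y) \<notin> E" if "x \<in> J C" "y \<in> J D" "C \<in> \<C>" "D \<in> \<C>" for x y C D
    proof (cases "C = D")
      case True
      then show ?thesis
        using that J(2) by (auto simp: indep_def)
    next
      case False
      then show ?thesis
        using that J(1) component_no_edge[OF \<C>] by blast
    qed
    have "(v, x) \<notin> E" "(x, v) \<notin> E" if "x \<in> J C" "C \<in> \<C>" for x C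
      using that JS E_sym[of x v] by (auto simp: S nbrs_def)
    then show ?thesis
      using no E_irrefl by (auto simp: I_def indep_def)
  qed
  moreover have "I \<subseteq> U"
    using JS v by (auto simp: I_def)
  moreover have "potential t U \<le> 7 * real (card I)"
  proof -
    have "(\<Sum>x\<in>C. weight t (deg U x)) \<le> potential t C + (2 * t - t * edges C S)"
      if "C \<in> \<C>" for C
    proof -
      have "(\<Sum>x\<in>C. weight t (deg U x)) = (\<Sum>x\<in>C. weight t (deg C x + deg S x))"
        using deg_component[OF U(1) SU(1) \<C> that] by simp
      moreover have "deg C x + deg S x \<le> 3" if "x \<in> C" for x
        using deg_component[OF U(1) SU(1) \<C> \<open>C \<in> \<C>\<close> that] U(3)[of x] CU[OF \<open>C \<in> \<C>\<close>] that
        by auto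
      moreover have "conn C"
        using \<C> that by (simp add: components_of_def)
      ultimately show ?thesis
        using potential_component_ge[OF t _ finC[OF that] fin(1)]
          component_edges_pos[OF U(1,2) SU \<C> that] by fastforce
    qed
    then have "(\<Sum>C\<in>\<C>. \<Sum>x\<in>C. weight t (deg U x))
        \<le> (\<Sum>C\<in>\<C>. 7 * real (card (J C)) + (2 * t - t * edges C S))"
      using J(3) by (intro sum_mono) force
    then have "(\<Sum>x\<in>U - S. weight t (deg U x))
        \<le> 7 * (\<Sum>C\<in>\<C>. real (card (J C))) + (\<Sum>C\<in>\<C>. 2 * t - t * edges C S)"
      by (simp add: sum_components_of[OF fin(2) \<C>] sum.distrib sum_distrib_left)
    moreover have "(\<Sum>x\<in>U. weight t (deg U x))
        = (\<Sum>x\<in>U - S. weight t (deg U x)) + (\<Sum>x\<in>S. weight t (deg U x))"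
      using sum.subset_diff[OF SU(1) U(1)] .
    ultimately show ?thesis
      using loss by (simp add: potential_def cardI)
  qed
  ultimately show ?thesis
    by blast
qed

text \<open>A component joined to \<open>S\<close> by one edge must avoid \<open>X\<close>: if it
  lies inside \<open>X\<close>, it is a smaller competitor of \<open>X\<close> since it misses
  \<open>S\<close>; if it crosses the boundary of \<open>X\<close>, then \<open>X - C\<close> is
  one. Hence its edge to \<open>S\<close> is the only edge leaving \<open>X\<close>, and two such
  components share the outer end of that edge.\<close>

lemma at_most_one_bridge_component:
  assumes U: "finite U"
    and X: "X \<subseteq> U" "edges X (U - X) \<le> 1"
    and min: "\<And>Y. Y \<subseteq> U \<Longrightarrow> Y \<noteq> {} \<Longrightarrow> edges Y (U - Y) \<le> 1 \<Longrightarrow> card X \<le> card Y"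
    and S: "S \<noteq> {}" "S \<subseteq> X" and \<C>: "components_of (U - S) \<C>"
    and CD: "C \<in> \<C>" "D \<in> \<C>" "edges C S \<le> 1" "edges D S \<le> 1"
    and pos: "1 \<le> edges C S" "1 \<le> edges D S"
  shows "C = D"
proof -
  have fin: "finite X" "finite (U - X)" "finite S"
    using U X S by (meson finite_subset finite_Diff)+
  have outside: "\<exists>x y. (x, y) \<in> E \<inter> X \<times> (U - X) \<and> y \<in> C"
    if C: "C \<in> \<C>" "edges C S \<le> 1" "1 \<le> edges C S" for C
  proof -
    have CU: "C \<subseteq> U - S" and connC: "conn C"
      using component_subset[OF \<C> C(1)] C \<C> by (auto simp: components_of_def)
    have finC: "finite C"
      using CU U by (auto intro: finite_subset)
    \<comment> \<open>Every edge leaving \<open>C\<close> ends in \<open>S\<close>, so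
      \<open>C\<close> is itself subject to the minimality of \<open>X\<close>.\<close>
    have "E \<inter> C \<times> (U - C) = E \<inter> C \<times> S"
      using CU S X neighbour_of_component[OF \<C> C(1)] by blast
    then have C1: "edges C (U - C) \<le> 1"
      using C by (simp add: edges_def)
    have "C \<inter> X = {}"
    proof (rule ccontr)
      assume ne: "C \<inter> X \<noteq> {}"
      show False
      proof (cases "C \<subseteq> X")
        case True
        then have "card C < card X"
          using S CU fin by (intro psubset_card_mono) auto
        moreover have "card X \<le> card C"
          using CU C1 connC by (intro min) (auto simp: conn_def)
        ultimately show False
          by simp
      next
        case False
        then obtain x y where xy: "x \<in> C \<inter> X" "y \<in> C - C \<inter> X" "(x, y) \<in> E"
          using connD[OF connC, of "C \<inter> X"] ne by blast
        \<comment> \<open>The only edge leaving \<open>X\<close> lies inside \<open>C\<close>, so removing \<open>C\<close> from \<open>X\<close> leaves a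
          smaller set with at most one outgoing edge.\<close>
        have "E \<inter> (X - C) \<times> (U - (X - C)) \<subseteq> E \<inter> (U - C) \<times> C"
        proof
          fix e assume "e \<in> E \<inter> (X - C) \<times> (U - (X - C))"
          then obtain a b where e: "e = (a, b)" "(a, b) \<in> E" "a \<in> X - C" "b \<in> U - (X - C)"
            by auto
          have "b \<in> C"
          proof (rule ccontr)
            assume "b \<notin> C"
            then have "(a, b) \<in> E \<inter> X \<times> (U - X)"
              using e by auto
            moreover have "(x, y) \<in> E \<inter> X \<times> (U - X)"
              using xy CU by auto
            ultimately have "a = x"
              using edges_le_1_unique(1)[OF fin(1,2) X(2)] by blast
            then show False
              using e xy by auto
          qed
          then show "e \<in> E \<inter> (U - C) \<times> C"
            using e X by auto
        qed
        moreover have "finite (E \<inter> (U - C) \<times> C)"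
          using U finC by auto
        ultimately have "edges (X - C) (U - (X - C)) \<le> edges (U - C) C"
          unfolding edges_def by (intro card_mono)
        then have "edges (X - C) (U - (X - C)) \<le> 1"
          using C1 edges_sym by simp
        then have "card X \<le> card (X - C)"
          using X S CU by (intro min) auto
        moreover have "card (X - C) < card X"
          using ne fin by (intro psubset_card_mono) auto
        ultimately show False
          by simp
      qed
    qed
    have "E \<inter> C \<times> S \<noteq> {}"
      using C(3) by (auto simp: edges_def)
    then obtain x y where "(x, y) \<in> E" "x \<in> C" "y \<in> S"
      by auto
    then have "(y, x) \<in> E \<inter> X \<times> (U - X) \<and> x \<in> C"
      using S CU \<open>C \<inter> X = {}\<close> E_sym by auto
    then show ?thesis
      by blast
  qed
  obtain x y x' y' where "(x, y) \<in> E \<inter> X \<times> (U - X)" "y \<in> C"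
      "(x', y') \<in> E \<inter> X \<times> (U - X)" "y' \<in> D"
    using outside[OF CD(1,3) pos(1)] outside[OF CD(2,4) pos(2)] by blast
  then have "C \<inter> D \<noteq> {}"
    using edges_le_1_unique(2)[OF fin(1,2) X(2)] by blast
  then show ?thesis
    using component_disjoint[OF \<C> CD(1,2)] by blast
qed

section \<open>Closed neighbourhoods and the inductive step by minimum degree\<close>

lemma deg_self: "deg {v} v = 0"
  using E_irrefl by (auto simp: deg_def nbrs_def card_eq_0_iff)

lemma one_le_deg:
  assumes "finite U" "conn U" "v \<in> U" "U \<noteq> {v}"
  shows "1 \<le> deg U v"
proof -
  obtain y where "y \<in> nbrs U v"
    using connD[OF assms(2), of "{v}"] assms(3,4) by (auto simp: nbrs_def)
  moreover have "finite (nbrs U v)"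
    using assms(1) by (simp add: nbrs_def)
  ultimately show ?thesis
    unfolding deg_def by (metis One_nat_def Suc_leI card_gt_0_iff empty_iff)
qed

lemma deg_outside_closed_nbrs:
  assumes "S = insert v (nbrs U v)"
  shows "deg (U - S) v = 0"
proof -
  have "nbrs (U - S) v = {}"
    using assms by (auto simp: nbrs_def)
  then show ?thesis
    by (simp add: deg_def)
qed

lemma finite_nbrs: "finite U \<Longrightarrow> finite (nbrs U v)"
  by (simp add: nbrs_def)

lemma not_in_nbrs: "v \<notin> nbrs U v"
  using E_irrefl by (simp add: nbrs_def)

text \<open>Let \<open>k\<close> be the number of edges leaving \<open>S = {v, u}\<close>; they all
  start at \<open>u\<close>, which has degree \<open>k + 1\<close>. The total deficit is at most
  \<open>t * k\<close>, and \<open>weight t 1 + weight t (k + 1) + t * k\<close> equals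
  \<open>7 + 2 * t\<close> for \<open>k = 1\<close> and \<open>k = 2\<close>. For
  \<open>k = 0\<close> it is larger by 1, which the correction term for a single edge
  absorbs.\<close>

lemma ex_indep_leaf:
  assumes t: "1 \<le> t" and U: "finite U" "conn U" "\<And>x. x \<in> U \<Longrightarrow> deg U x \<le> 3"
    and IH: "\<And>C. C \<subset> U \<Longrightarrow> conn C \<Longrightarrow> \<exists>I\<subseteq>C. indep I \<and> potential t C \<le> 7 * real (card I)"
    and v: "v \<in> U" "deg U v = 1"
  shows "\<exists>I\<subseteq>U. indep I \<and> potential t U \<le> 7 * real (card I)"
proof -
  obtain u where u: "nbrs U v = {u}"
    using v(2) by (auto simp: deg_def card_1_singleton_iff)
  define S where "S = insert v (nbrs U v)"
  have S: "S = {v, u}" and uv: "u \<noteq> v" "(v, u) \<in> E" "u \<in> U"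
    using u not_in_nbrs[of v U] nbrs_iff[of u U v] by (auto simp: S_def)
  have SU: "S \<subseteq> U" "S \<noteq> {}"
    using S uv v by auto
  have fin: "finite S" "finite (U - S)"
    using S U by auto
  obtain \<C> where \<C>: "components_of (U - S) \<C>"
    using ex_components_of[OF fin(2)] by blast
  have pos: "1 \<le> edges C S" if "C \<in> \<C>" for C
    using component_edges_pos[OF U(1,2) SU \<C> that] .
  have "nbrs S u = {v}"
    using S uv E_sym E_irrefl by (auto simp: nbrs_def)
  then have "deg S u = 1"
    by (simp add: deg_def)
  moreover have "deg U u = deg S u + deg (U - S) u"
    using deg_Un[OF fin, of u] SU by (simp add: Un_absorb1)
  ultimately have degu: "deg U u = 1 + edges S (U - S)"
    using S uv deg_outside_closed_nbrs[OF S_def] fin by (simp add: edges_eq_sum_deg)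
  have total: "(\<Sum>C\<in>\<C>. edges C S) = edges S (U - S)"
    using sum_component_edges[OF U(1) SU(1) \<C>] .
  \<comment> \<open>Since \<open>edges C S \<ge> 1\<close>, the term \<open>2 * t\<close> is at most
    twice \<open>t * edges C S\<close>.\<close>
  have "(\<Sum>C\<in>\<C>. 2 * t - t * edges C S) \<le> (\<Sum>C\<in>\<C>. t * edges C S)"
  proof (rule sum_mono)
    fix C assume "C \<in> \<C>"
    then have "t * 1 \<le> t * real (edges C S)"
      using pos t by (intro mult_left_mono) auto
    then show "2 * t - t * edges C S \<le> t * edges C S"
      by simp
  qed
  also have "\<dots> = t * real (edges S (U - S))"
    by (simp add: sum_distrib_left flip: total)
  finally have le: "(\<Sum>C\<in>\<C>. 2 * t - t * edges C S) \<le> t * real (edges S (U - S))" .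
  \<comment> \<open>If no edge leaves \<open>S\<close>, connectedness forces \<open>U = S\<close>, a
    single edge.\<close>
  have card2: "card U = 2" if "edges S (U - S) = 0"
  proof -
    have "U = S"
    proof (rule ccontr)
      assume "U \<noteq> S"
      then have "S \<subset> U"
        using SU by auto
      then obtain x y where "x \<in> S" "y \<in> U - S" "(x, y) \<in> E"
        using connD[OF U(2)] SU by metis
      then show False
        using edges_pos[OF fin] that by force
    qed
    then show ?thesis
      using S uv by simp
  qed
  have "edges S (U - S) = 0 \<or> edges S (U - S) = 1 \<or> edges S (U - S) = 2"
    using U(3)[OF uv(3)] degu by linarith
  then have "(\<Sum>s\<in>S. weight t (deg U s)) + t * real (edges S (U - S))
      \<le> 7 + 2 * t + of_bool (card U = 2)"
    using S uv v(2) degu card2 t by (elim disjE) (auto simp: weight_def)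
  then show ?thesis
    using le by (intro ex_indep_reduction[OF t U IH v(1) S_def \<C>]) auto
qed

lemma ex_indep_deg_ge_2:
  assumes t: "1 \<le> t" and U: "finite U" "conn U" "\<And>x. x \<in> U \<Longrightarrow> deg U x \<le> 3"
    and IH: "\<And>C. C \<subset> U \<Longrightarrow> conn C \<Longrightarrow> \<exists>I\<subseteq>C. indep I \<and> potential t C \<le> 7 * real (card I)"
    and deg2: "\<And>x. x \<in> U \<Longrightarrow> 2 \<le> deg U x"
  shows "\<exists>I\<subseteq>U. indep I \<and> potential t U \<le> 7 * real (card I)"
proof -
  define P where "P Y \<longleftrightarrow> Y \<subseteq> U \<and> Y \<noteq> {} \<and> edges Y (U - Y) \<le> 1" for Y
  \<comment> \<open>No edge leaves \<open>U\<close> itself, so a smallest set \<open>X\<close> with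
    \<open>P X\<close> exists; it may be all of \<open>U\<close>.\<close>
  have "P U"
    using U by (auto simp: P_def edges_def conn_def)
  then obtain X where PX: "P X" and min: "\<And>Y. P Y \<Longrightarrow> card X \<le> card Y"
    using ex_has_least_nat[of P U card] by blast
  have X: "X \<subseteq> U" "X \<noteq> {}" "edges X (U - X) \<le> 1"
    using PX by (auto simp: P_def)
  have finX: "finite X" "finite (U - X)"
    using X U by (auto intro: finite_subset)
  have nbrs2: "\<exists>z\<in>nbrs U x. z \<noteq> y" if "x \<in> U" for x y
  proof (rule ccontr)
    assume "\<not> ?thesis"
    then have "nbrs U x \<subseteq> {y}"
      by blast
    then have "card (nbrs U x) \<le> card {y}"
      by (intro card_mono) auto
    then show False
      using deg2[OF that] by (simp add: deg_def)
  qed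
  \<comment> \<open>For a closed neighbourhood inside \<open>X\<close>, minimality leaves at most
    one component attached by a single edge, so the total deficit is at most
    \<open>t\<close>.\<close>
  have reduce: ?thesis
    if v: "v \<in> X" "nbrs U v \<subseteq> X" and "deg U v = 2 \<or> (\<forall>x\<in>X. deg U x = 3)" for v
  proof -
    define S where "S = insert v (nbrs U v)"
    have SU: "S \<subseteq> U" "S \<noteq> {}" "S \<subseteq> X"
      using v X by (auto simp: S_def)
    have fin: "finite S" "finite (U - S)"
      using SU U by (auto intro: finite_subset)
    have cardS: "card S = 1 + deg U v"
      using fin(1) not_in_nbrs[of v U] by (simp add: S_def deg_def)
    obtain \<C> where \<C>: "components_of (U - S) \<C>"
      using ex_components_of[OF fin(2)] by blast
    have pos: "1 \<le> edges C S" if "C \<in> \<C>" for C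
      using component_edges_pos[OF U(1,2) SU(1,2) \<C> that] .
    have unique: "C = D" if "C \<in> \<C>" "D \<in> \<C>" "edges C S \<le> 1" "edges D S \<le> 1" for C D
    proof (rule at_most_one_bridge_component[OF U(1) X(1,3) _ SU(2,3) \<C> that])
      show "card X \<le> card Y" if "Y \<subseteq> U" "Y \<noteq> {}" "edges Y (U - Y) \<le> 1" for Y
        using min that by (simp add: P_def)
    qed (use pos that in auto)
    have fin\<C>: "finite \<C>"
      using finite_components_of[OF fin(2) \<C>] .
    have "0 \<le> t"
      using t by simp
    note deficit = sum_deficit_le[OF fin\<C> \<open>0 \<le> t\<close>, of "\<lambda>C. edges C S", OF pos unique]
    have vU: "v \<in> U"
      using v X by blast
    have "(\<Sum>s\<in>S. weight t (deg U s)) + (\<Sum>C\<in>\<C>. 2 * t - t * edges C S) \<le> 7 + 2 * t"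
    proof (cases "deg U v = 2")
      case False
      then have "\<forall>x\<in>S. deg U x = 3"
        using that(3) SU by blast
      moreover from this have "card S = 4"
        using cardS by (simp add: S_def)
      \<comment> \<open>Adding the deficit \<open>t\<close> gives \<open>12 - 3 * t\<close>, which
        is at most \<open>7 + 2 * t\<close> exactly when \<open>t \<ge> 1\<close>, that is, when
        \<open>c1 \<ge> 5/7\<close>.\<close>
      ultimately have "(\<Sum>s\<in>S. weight t (deg U s)) = 4 * (3 - t)"
        by (simp add: weight_def)
      then show ?thesis
        using deficit(1) t by simp
    next
      case True
      then obtain a b where ab: "nbrs U v = {a, b}" "a \<noteq> b"
        by (auto simp: deg_def card_2_iff)
      then have S: "S = {v, a, b}" and abv: "v \<noteq> a" "v \<noteq> b" "(v, a) \<in> E" "(v, b) \<in> E" "a \<in> U" "b \<in> U"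
        using not_in_nbrs[of v U] nbrs_iff[of a U v] nbrs_iff[of b U v] by (auto simp: S_def)
      have loss: "(\<Sum>s\<in>S. weight t (deg U s)) = 3 + weight t (deg U a) + weight t (deg U b)"
        using ab abv True by (simp add: S weight_def)
      have degs: "deg U a = 2 \<or> deg U a = 3" "deg U b = 2 \<or> deg U b = 3"
        using deg2[OF abv(5)] deg2[OF abv(6)] U(3)[OF abv(5)] U(3)[OF abv(6)] by auto
      show ?thesis
      proof (cases "deg U a = 2 \<and> deg U b = 2")
        case False
        \<comment> \<open>A neighbour of degree 3 saves \<open>t\<close>; with the deficit
          \<open>t\<close> the total is at most 9, hence at most \<open>7 + 2 * t\<close>.\<close>
        then have "(\<Sum>s\<in>S. weight t (deg U s)) \<le> 9 - t"
          using degs t unfolding loss by (auto simp: weight_def)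
        then show ?thesis
          using deficit(1) t by simp
      next
        case True
        \<comment> \<open>Now the weight of \<open>S\<close> is 9, so for \<open>t = 1\<close> no
          positive deficit is affordable. The number of edges leaving \<open>S\<close> is 0 or 2,
          according to whether \<open>a\<close> and \<open>b\<close> are adjacent, so the parity
          case of \<open>sum_deficit_le\<close> applies.\<close>
        have "edges S (U - S) = deg (U - S) a + deg (U - S) b"
          using fin ab abv deg_outside_closed_nbrs[OF S_def] by (simp add: edges_eq_sum_deg S)
        moreover have "deg S a + deg (U - S) a = 2" "deg S b + deg (U - S) b = 2"
          using deg_Un[OF fin] SU True by (auto simp: Un_absorb1)
        moreover have "deg S a = deg S b \<and> 1 \<le> deg S b"
        proof -
          have "nbrs S a = (if (a, b) \<in> E then {v, b} else {v})"
            "nbrs S b = (if (a, b) \<in> E then {v, a} else {v})"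
            using S abv E_sym E_irrefl by (auto simp: nbrs_def)
          then show ?thesis
            using abv by (simp add: deg_def)
        qed
        ultimately have "edges S (U - S) = 2 * deg (U - S) b \<and> deg (U - S) b \<le> 1"
          by linarith
        then have "even (edges S (U - S))" "edges S (U - S) \<le> 2"
          by auto
        then have "(\<Sum>C\<in>\<C>. 2 * t - t * edges C S) \<le> 0"
          using deficit(2) by (simp add: sum_component_edges[OF U(1) SU(1) \<C>])
        then show ?thesis
          using True t unfolding loss by (simp add: weight_def)
      qed
    qed
    then show ?thesis
      by (intro ex_indep_reduction[OF t U IH vU S_def \<C>]) auto
  qed
  have exits: "x = x'" "y = y'"
    if "x \<in> X" "y \<in> nbrs U x - X" "x' \<in> X" "y' \<in> nbrs U x' - X" for x y x' y'
    using edges_le_1_unique[OF finX X(3), of x y x' y'] that by (auto simp: nbrs_def)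
  show ?thesis
  proof (cases "\<exists>v\<in>X. nbrs U v \<subseteq> X \<and> deg U v = 2")
    case True
    then show ?thesis
      using reduce by blast
  next
    case False
    have deg3: "deg U x = 3" if x: "x \<in> X" for x
    proof (rule ccontr)
      assume "deg U x \<noteq> 3"
      then have degx: "deg U x = 2"
        using deg2[of x] U(3)[of x] x X by force
      then obtain y where y: "y \<in> nbrs U x - X"
        using False x by blast
      obtain z where z: "z \<in> nbrs U x" "z \<noteq> y"
        using nbrs2 x X by blast
      then have "z \<in> X"
        using exits(2)[OF x y x] by blast
      have nx: "nbrs U x = {y, z}"
      proof (rule sym, rule card_subset_eq)
        show "card {y, z} = card (nbrs U x)"
          using degx z by (simp add: deg_def)
      qed (use y z finite_nbrs[OF U(1)] in auto)
      \<comment> \<open>Moving a vertex of degree 2 out of \<open>X\<close> only moves the outgoing edge.\<close>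
      have "E \<inter> (X - {x}) \<times> (U - (X - {x})) \<subseteq> {(z, x)}"
      proof
        fix e assume "e \<in> E \<inter> (X - {x}) \<times> (U - (X - {x}))"
        then obtain c d where e: "e = (c, d)" "(c, d) \<in> E" "c \<in> X - {x}" "d \<in> U - (X - {x})"
          by auto
        have "d = x"
        proof (rule ccontr)
          assume "d \<noteq> x"
          then have "d \<in> nbrs U c - X"
            using e by (auto simp: nbrs_def)
          then show False
            using exits(1)[OF x y] e by blast
        qed
        moreover have "c \<in> nbrs U x"
          using e X E_sym \<open>d = x\<close> by (auto simp: nbrs_def)
        ultimately show "e \<in> {(z, x)}"
          using nx y e by auto
      qed
      then have "edges (X - {x}) (U - (X - {x})) \<le> card {(z, x)}"
        unfolding edges_def by (intro card_mono) auto
      moreover have "z \<in> X - {x}"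
        using z \<open>z \<in> X\<close> not_in_nbrs[of x U] by auto
      ultimately have "P (X - {x})"
        using X by (auto simp: P_def)
      moreover have "card (X - {x}) < card X"
        using x finX by (intro card_Diff1_less)
      ultimately show False
        using min[of "X - {x}"] by simp
    qed
    obtain x where x: "x \<in> X"
      using X by blast
    \<comment> \<open>At most one vertex of \<open>X\<close> has a neighbour outside. If
      \<open>x\<close> is that vertex, it has another neighbour \<open>z\<close>, which lies in
      \<open>X\<close> and has its whole neighbourhood there.\<close>
    have "\<exists>v\<in>X. nbrs U v \<subseteq> X"
    proof (cases "nbrs U x \<subseteq> X")
      case False
      then obtain y where y: "y \<in> nbrs U x - X"
        by blast
      obtain z where z: "z \<in> nbrs U x" "z \<noteq> y"
        using nbrs2 x X by blast
      have "z \<in> X"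
        using exits(2)[OF x y x] z by blast
      moreover have "z \<noteq> x"
        using z not_in_nbrs[of x U] by auto
      ultimately show ?thesis
        using exits(1)[OF x y] by blast
    qed (use x in blast)
    then show ?thesis
      using reduce deg3 by blast
  qed
qed

text \<open>Strong induction over connected vertex sets, whose degree bound passes to subsets. A
  connected set is a single vertex, contains a leaf, or has minimum degree at least 2.\<close>

theorem ex_indep_potential_le:
  assumes "1 \<le> t" "finite U" "conn U" "\<And>x. x \<in> U \<Longrightarrow> deg U x \<le> 3"
  shows "\<exists>I\<subseteq>U. indep I \<and> potential t U \<le> 7 * real (card I)"
  using assms(2,3,4)
proof (induction "card U" arbitrary: U rule: less_induct)
  case less
  have IH: "\<exists>I\<subseteq>C. indep I \<and> potential t C \<le> 7 * real (card I)" if "C \<subset> U" "conn C" for C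
  proof (rule less.hyps)
    show "card C < card U"
      using that less.prems by (intro psubset_card_mono)
    show "finite C"
      using that less.prems by (auto intro: finite_subset)
    show "deg C x \<le> 3" if "x \<in> C" for x
      using deg_mono[OF less.prems(1), of C x] less.prems(3)[of x] \<open>C \<subset> U\<close> that
      by fastforce
  qed (rule that)
  consider v where "U = {v}" | v where "v \<in> U" "deg U v = 1"
    | "\<And>x. x \<in> U \<Longrightarrow> 2 \<le> deg U x"
    using one_le_deg[OF less.prems(1,2)]
    by (metis One_nat_def Suc_leI le_neq_implies_less numeral_2_eq_2)
  then show ?case
  proof cases
    case 1
    \<comment> \<open>The value of \<open>weight\<close> at degree 0 makes the potential exactly 7,
      matched by the vertex itself.\<close>
    then show ?thesis
      using E_irrefl deg_self
      by (intro exI[of _ U]) (simp add: indep_def potential_def weight_def)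
  next
    case 2
    then show ?thesis
      using ex_indep_leaf[OF assms(1) less.prems IH] by blast
  next
    case 3
    then show ?thesis
      using ex_indep_deg_ge_2[OF assms(1) less.prems IH] by blast
  qed
qed

end

section \<open>Independence number and degree counts of the classes\<close>

lemma degree_eq_card: "degree G v = card {u. (v, u) \<in> parcs G}"
proof -
  have "out_arcs (with_proj G) v = Pair v ` {u. (v, u) \<in> parcs G}"
    by (auto simp: out_arcs_def)
  then show ?thesis
    by (simp add: out_degree_def card_image inj_on_def)
qed

lemma finite_independent_sets:
  "finite (pverts G) \<Longrightarrow> finite {S. independent_set G S}"
  by (rule finite_subset[of _ "Pow (pverts G)"]) (auto simp: independent_set_def)

lemma card_le_independence_number:
  assumes "finite (pverts G)" "independent_set G S"
  shows "card S \<le> independence_number G"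
  unfolding independence_number_def
  using assms finite_independent_sets[of G] by (intro Max_ge) auto

lemma ex_independent_set_max:
  assumes "finite (pverts G)"
  obtains S where "independent_set G S" "card S = independence_number G"
proof -
  have "independent_set G {}"
    by (simp add: independent_set_def)
  then have "Max (card ` {S. independent_set G S}) \<in> card ` {S. independent_set G S}"
    using finite_independent_sets[OF assms] by (intro Max_in) auto
  then show ?thesis
    using that by (auto simp: independence_number_def)
qed

lemma independence_number_eqI:
  assumes "finite (pverts G)" "independent_set G I" "card I = k"
    and "\<And>S. independent_set G S \<Longrightarrow> card S \<le> k"
  shows "independence_number G = k"
  using assms ex_independent_set_max card_le_independence_number by (metis le_antisym)

text \<open>Isolated vertices are excluded, so the auxiliary value of \<open>weight\<close> at
  degree 0 does not enter.\<close>

lemma sum_weight_degree: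
  assumes "finite (pverts G)" "\<And>v. v \<in> pverts G \<Longrightarrow> 1 \<le> degree G v \<and> degree G v \<le> 3"
  shows "(\<Sum>v\<in>pverts G. weight t (degree G v)) = (4 + t) * card (deg_verts 1 G)
    + 3 * card (deg_verts 2 G) + (3 - t) * card (deg_verts 3 G)"
proof -
  have w: "weight t d = (4 + t) * of_bool (d = 1) + 3 * of_bool (d = 2) + (3 - t) * of_bool (d = 3)"
    if "1 \<le> d \<and> d \<le> 3" for d
  proof -
    have "d = 1 \<or> d = 2 \<or> d = 3"
      using that by auto
    then show ?thesis
      by (auto simp: weight_def)
  qed
  have card: "(\<Sum>v\<in>pverts G. of_bool (degree G v = i) :: real) = card (deg_verts i G)" for i
    using assms(1) by (simp add: deg_verts_def Int_def)
  have "(\<Sum>v\<in>pverts G. weight t (degree G v)) = (\<Sum>v\<in>pverts G. (4 + t) * of_bool (degree G v = 1)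
      + 3 * of_bool (degree G v = 2) + (3 - t) * of_bool (degree G v = 3))"
    using assms(2) by (intro sum.cong refl w)
  then show ?thesis
    by (simp only: sum.distrib card flip: sum_distrib_left)
qed

text \<open>The whole vertex set is connected in the sense of cuts and has at least 3 vertices, so
  the correction term of the potential vanishes.\<close>

lemma class_G_bound:
  fixes c :: real
  assumes "5/7 \<le> c" "G \<in> class_G"
  shows "c * card (deg_verts 1 G) + 3/7 * card (deg_verts 2 G)
    + (1 - c) * card (deg_verts 3 G) - (2 * c - 8/7) \<le> independence_number G"
proof -
  let ?U = "pverts G"
  have G: "pair_graph G" "Digraph_Component.connected (with_proj G)"
    "\<And>v. v \<in> ?U \<Longrightarrow> degree G v \<le> 3" "3 \<le> card ?U"
    using assms(2) by (auto simp: class_G_def)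
  interpret pair_graph G
    by (rule G(1))
  have sym: "(v, u) \<in> parcs G" if "(u, v) \<in> parcs G" for u v
    using pair_sym_arcs that by (auto simp: symmetric_def dest: symD)
  interpret E: edge_relation "parcs G"
  proof
    show "(v, v) \<notin> parcs G" for v
      using pair_no_loops[of "(v, v)"] by auto
  qed (rule sym)
  have fin: "finite ?U"
    by (rule pair_finite_verts)
  have deg: "E.deg ?U v = degree G v" for v
    using in_arcsD2 unfolding E.deg_def E.nbrs_def degree_eq_card
    by (metis (no_types, lifting))
  have sc: "strongly_connected (with_proj G)"
    using symmetric_connected_imp_strongly_connected[OF pair_sym_arcs G(2)] .
  have conn: "E.conn ?U"
    unfolding E.conn_def
  proof (intro conjI allI impI)
    show "?U \<noteq> {}"
      using G(4) by auto
    fix A assume A: "A \<subset> ?U" "A \<noteq> {}"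
    then obtain x z where xz: "x \<in> A" "z \<in> ?U - A"
      by blast
    show "\<exists>x\<in>A. \<exists>y\<in>?U - A. (x, y) \<in> parcs G"
    proof (rule ccontr)
      \<comment> \<open>Without an arc leaving \<open>A\<close>, everything reachable from a vertex
        of \<open>A\<close> would stay in \<open>A\<close>.\<close>
      assume no: "\<not> ?thesis"
      have "x \<rightarrow>\<^sup>*\<^bsub>with_proj G\<^esub> z"
        using sc xz A unfolding strongly_connected_def by auto
      then have "z \<in> A"
      proof (induction rule: reachable_induct)
        case base
        then show ?case
          using xz by simp
      next
        case (step a b)
        then show ?case
          using no in_arcsD2 by auto
      qed
      then show False
        using xz by simp
    qed
  qed
  \<comment> \<open>With this \<open>t\<close>, division by 7 turns \<open>4 + t\<close> into
    \<open>c\<close>, \<open>3 - t\<close> into \<open>1 - c\<close> and \<open>2 * t\<close> into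
    \<open>2 * c - 8/7\<close>.\<close>
  define t where "t = 7 * c - 4"
  have "1 \<le> t"
    using assms(1) by (simp add: t_def)
  then obtain I where I: "I \<subseteq> ?U" "E.indep I" "E.potential t ?U \<le> 7 * real (card I)"
    using E.ex_indep_potential_le[OF _ fin conn, of t] G(3) unfolding deg by blast
  have "independent_set G I"
    using I by (simp add: independent_set_def E.indep_def)
  then have "card I \<le> independence_number G"
    using card_le_independence_number[OF fin] by blast
  moreover have "1 \<le> degree G v" if "v \<in> ?U" for v
    using E.one_le_deg[OF fin conn that] G(4) deg by fastforce
  then have "E.potential t ?U = (4 + t) * card (deg_verts 1 G)
    + 3 * card (deg_verts 2 G) + (3 - t) * card (deg_verts 3 G) - 2 * t"
    using sum_weight_degree[OF fin, of t] G(3,4) by (simp add: E.potential_def deg)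
  ultimately have "(4 + t) * card (deg_verts 1 G) + 3 * card (deg_verts 2 G)
      + (3 - t) * card (deg_verts 3 G) - 2 * t \<le> 7 * real (independence_number G)"
    using I(3) by linarith
  then show ?thesis
    by (simp add: t_def algebra_simps)
qed

text \<open>With \<open>n\<close> path vertices, the \<open>n\<close> pendant vertices are the
  leaves and form a maximum independent set. The two ends of the path have degree 2 and its inner
  vertices degree 3.\<close>

lemma class_B_counts:
  assumes "G \<in> class_B"
  obtains n where "2 \<le> n" "independence_number G = n" "card (deg_verts 1 G) = n"
    "card (deg_verts 2 G) = 2" "card (deg_verts 3 G) = n - 2"
proof -
  obtain f p where G: "G = attach_pendants f (path_graph p)" and p: "2 \<le> length p" "distinct p"
    and f: "inj_on f (set p)" "f ` set p \<inter> set p = {}"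
    using assms by (auto simp: class_B_def)
  define n where "n = length p"
  have n: "2 \<le> n"
    using p n_def by simp
  have V: "pverts G = set p \<union> f ` set p" and fin: "finite (pverts G)"
    by (simp_all add: G attach_pendants_def path_graph_def)
  \<comment> \<open>Separating path adjacency from the pendant edges lets the degrees be counted by
    list positions.\<close>
  define Q where
    "Q u v \<longleftrightarrow> (\<exists>i. Suc i < n \<and> (u = p ! i \<and> v = p ! Suc i \<or> v = p ! i \<and> u = p ! Suc i))" for u v
  have arcs: "(u, v) \<in> parcs G \<longleftrightarrow> Q u v \<or> u \<in> set p \<and> v = f u \<or> v \<in> set p \<and> u = f v" for u v
    by (auto simp: G attach_pendants_def path_graph_def symcl_def n_def image_iff Q_def)
  have pn: "p ! i \<in> set p" if "i < n" for i
    using that by (simp add: n_def)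
  have Q_set: "u \<in> set p \<and> v \<in> set p" if "Q u v" for u v
    using that pn unfolding Q_def by (metis Suc_lessD)
  have fp: "f v \<notin> set p" if "v \<in> set p" for v
    using f(2) that by blast
  have pi: "p ! i = p ! j \<longleftrightarrow> i = j" if "i < n" "j < n" for i j
    using that p(2) by (simp add: n_def nth_eq_iff_index_eq)
  have Q_nth: "Q (p ! i) u \<longleftrightarrow> (\<exists>j<n. u = p ! j \<and> (j = Suc i \<or> i = Suc j))" if "i < n" for i u
    unfolding Q_def using that pi by (metis Suc_lessD)
  have deg_f: "degree G (f v) = 1" if v: "v \<in> set p" for v
  proof -
    have "(f v, u) \<in> parcs G \<longleftrightarrow> u = v" for u
      using v fp[OF v] Q_set[of "f v" u] inj_onD[OF f(1), of v u] unfolding arcs by blast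
    then show ?thesis
      by (simp add: degree_eq_card)
  qed
  have deg_p: "degree G (p ! i) = (if i = 0 \<or> i = n - 1 then 2 else 3)" if i: "i < n" for i
  proof -
    let ?J = "{j. j < n \<and> (j = Suc i \<or> i = Suc j)}"
    have "(p ! i, u) \<in> parcs G \<longleftrightarrow> u = f (p ! i) \<or> u \<in> (!) p ` ?J" for u
      using pn[OF i] fp unfolding arcs Q_nth[OF i] by (auto simp: image_iff)
    then have "{u. (p ! i, u) \<in> parcs G} = insert (f (p ! i)) ((!) p ` ?J)"
      by blast
    moreover have "f (p ! i) \<notin> (!) p ` ?J"
      using fp[OF pn[OF i]] pn by auto
    moreover have "inj_on ((!) p) ?J"
      using pi by (auto intro: inj_onI)
    ultimately have "degree G (p ! i) = Suc (card ?J)"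
      by (simp add: degree_eq_card card_image)
    \<comment> \<open>Since \<open>n \<ge> 2\<close>, each end has exactly one neighbour on the
      path; the \<open>Suc\<close> above accounts for the pendant edge.\<close>
    moreover have "?J = (if i = 0 then {1} else if i = n - 1 then {n - 2} else {i - 1, i + 1})"
      using i n by auto
    ultimately show ?thesis
      using n by auto
  qed
  have setp: "set p = (!) p ` {..<n}"
    by (auto simp: n_def set_conv_nth)
  have inj: "inj_on ((!) p) {..<n}"
    using pi by (auto intro: inj_onI)
  have degs: "deg_verts k G = {v \<in> f ` set p. k = 1} \<union> (!) p ` {i. i < n \<and> k = (if i = 0 \<or> i = n - 1 then 2 else 3)}" for k
    using deg_f deg_p pn unfolding deg_verts_def V by (auto simp: setp)
  have "deg_verts 1 G = f ` set p"
    unfolding degs by auto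
  then have c1: "card (deg_verts 1 G) = n"
    using f(1) p(2) by (simp add: card_image distinct_card n_def)
  have "deg_verts 2 G = (!) p ` {0, n - 1}"
    using n unfolding degs by (intro Un_absorb1 equalityI) (auto split: if_splits)
  moreover have "card ((!) p ` {0, n - 1}) = card {0, n - 1}"
    using n by (intro card_image inj_on_subset[OF inj]) auto
  ultimately have c2: "card (deg_verts 2 G) = 2"
    using n by simp
  have "deg_verts 3 G = (!) p ` {1..<n - 1}"
    using n unfolding degs by (auto split: if_splits)
  moreover have "card ((!) p ` {1..<n - 1}) = card {1..<n - 1}"
    using n by (intro card_image inj_on_subset[OF inj]) auto
  ultimately have c3: "card (deg_verts 3 G) = n - 2"
    by simp
  have "independence_number G = n"
  proof (rule independence_number_eqI[OF fin])
    have "(f u, f v) \<notin> parcs G" if "u \<in> set p" "v \<in> set p" for u v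
      using that fp Q_set unfolding arcs by blast
    then show "independent_set G (f ` set p)"
      by (auto simp: independent_set_def V)
    show "card (f ` set p) = n"
      using f(1) p(2) by (simp add: card_image distinct_card n_def)
    fix S assume S: "independent_set G S"
    have "S = (S \<inter> set p) \<union> (S \<inter> f ` set p)"
      using S by (auto simp: independent_set_def V)
    then have "card S \<le> card (S \<inter> set p) + card (S \<inter> f ` set p)"
      using card_Un_le by metis
    \<comment> \<open>Exchange argument: each path vertex in \<open>S\<close> is replaced by its
      pendant neighbour, which is not in \<open>S\<close> by independence.\<close>
    also have "card (S \<inter> set p) = card (f ` (S \<inter> set p))"
      using f(1) by (intro card_image[symmetric]) (auto intro: inj_on_subset)
    also have "\<dots> + card (S \<inter> f ` set p) = card (f ` (S \<inter> set p) \<union> S \<inter> f ` set p)"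
      using S by (intro card_Un_disjoint[symmetric]) (auto simp: independent_set_def arcs)
    also have "\<dots> \<le> card (f ` set p)"
      by (intro card_mono) auto
    also have "\<dots> \<le> n"
      unfolding n_def by (meson card_image_le card_length finite_set le_trans)
    finally show "card S \<le> n" .
  qed
  with n c1 c2 c3 show ?thesis
    using that by blast
qed

text \<open>The equation is the claim for \<open>c1 = 5/7\<close> multiplied by 7. Attaching a
  triangle raises the degree of \<open>x\<close> from 2 to 3 and adds one vertex of degree 3 and two
  of degree 2. The right side thus grows by \<open>3 + 2 * 2 = 7\<close>, matching one more
  independent vertex. Finiteness and the location of the arcs are carried along for the
  induction.\<close>

lemma class_A_counts:
  assumes "G \<in> class_A"
  shows "finite (pverts G) \<and> parcs G \<subseteq> pverts G \<times> pverts G \<and>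
    7 * independence_number G + 2
      = 5 * card (deg_verts 1 G) + 3 * card (deg_verts 2 G) + 2 * card (deg_verts 3 G)"
  using assms
proof (induction rule: class_A.induct)
  case (triangle T)
  then have T: "finite (pverts T)" "card (pverts T) = 3"
    "parcs T = {(u, v). (u, v) \<in> pverts T \<times> pverts T \<and> u \<noteq> v}"
    by (auto simp: complete_digraph_pair_def)
  have deg: "degree T v = 2" if "v \<in> pverts T" for v
  proof -
    have "{u. (v, u) \<in> parcs T} = pverts T - {v}"
      using that by (auto simp: T(3))
    then show ?thesis
      using T(1,2) that by (simp add: degree_eq_card)
  qed
  have d: "deg_verts 1 T = {}" "deg_verts 2 T = pverts T" "deg_verts 3 T = {}"
    using deg by (auto simp: deg_verts_def)
  have "pverts T \<noteq> {}"
    using T(2) by auto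
  then obtain a where a: "a \<in> pverts T"
    by blast
  have "independence_number T = 1"
  proof (rule independence_number_eqI[OF T(1)])
    show "independent_set T {a}"
      using a by (simp add: independent_set_def T(3))
    fix S assume "independent_set T S"
    then show "card S \<le> 1"
      unfolding independent_set_def T(3)
      by (auto simp: card_le_Suc0_iff_eq finite_subset[OF _ T(1)])
  qed simp
  then show ?case
    using T(1,2) unfolding T(3) d by auto
next
  case (attach G x T y)
  let ?H = "\<lparr>pverts = pverts G \<union> pverts T, parcs = parcs G \<union> parcs T \<union> {(x, y), (y, x)}\<rparr>"
  have G: "finite (pverts G)" "parcs G \<subseteq> pverts G \<times> pverts G"
    "7 * independence_number G + 2
      = 5 * card (deg_verts 1 G) + 3 * card (deg_verts 2 G) + 2 * card (deg_verts 3 G)"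
    using attach.IH by auto
  have T: "finite (pverts T)" "card (pverts T) = 3"
    "parcs T = {(u, v). (u, v) \<in> pverts T \<times> pverts T \<and> u \<noteq> v}"
    using attach.hyps by (auto simp: complete_digraph_pair_def)
  have disj: "pverts T \<inter> pverts G = {}" and x: "x \<in> pverts G" and y: "y \<in> pverts T"
    using attach.hyps by auto
  have arcs_H: "(u, v) \<in> parcs ?H \<longleftrightarrow> (u, v) \<in> parcs G \<or> u \<in> pverts T \<and> v \<in> pverts T \<and> u \<noteq> v
      \<or> u = x \<and> v = y \<or> u = y \<and> v = x" for u v
    by (auto simp: T(3))
  have deg_G: "degree ?H v = degree G v + of_bool (v = x)" if v: "v \<in> pverts G" for v
  proof -
    have "{u. (v, u) \<in> parcs ?H} = {u. (v, u) \<in> parcs G} \<union> {u. u = y \<and> v = x}"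
      using v disj y unfolding arcs_H by auto
    moreover have "{u. (v, u) \<in> parcs G} \<inter> {u. u = y \<and> v = x} = {}"
      using G(2) disj y by auto
    moreover have "finite {u. (v, u) \<in> parcs G}"
      using G(1,2) by (auto intro: finite_subset[of _ "pverts G"])
    ultimately show ?thesis
      by (auto simp: degree_eq_card card_Un_disjoint)
  qed
  have deg_T: "degree ?H v = 2 + of_bool (v = y)" if v: "v \<in> pverts T" for v
  proof -
    have "{u. (v, u) \<in> parcs ?H} = (pverts T - {v}) \<union> {u. u = x \<and> v = y}"
      using v disj x G(2) unfolding arcs_H by auto
    moreover have "(pverts T - {v}) \<inter> {u. u = x \<and> v = y} = {}"
      using disj x by auto
    moreover have "card (pverts T - {v}) = 2"
      using v T by simp
    ultimately show ?thesis
      using T(1) by (auto simp: degree_eq_card card_Un_disjoint)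
  qed
  have degs: "deg_verts k ?H = {v \<in> pverts G. degree G v + of_bool (v = x) = k}
      \<union> {v \<in> pverts T. 2 + of_bool (v = y) = k}" for k
    using deg_G deg_T unfolding deg_verts_def by auto
  have degx: "degree G x = 2"
    using attach.hyps by simp
  have "deg_verts 1 ?H = deg_verts 1 G"
    unfolding degs using degx by (auto simp: deg_verts_def)
  moreover have "card (deg_verts 2 ?H) = card (deg_verts 2 G) + 1"
  proof -
    have "deg_verts 2 ?H = (deg_verts 2 G - {x}) \<union> (pverts T - {y})"
      unfolding degs using degx by (auto simp: deg_verts_def)
    moreover have "(deg_verts 2 G - {x}) \<inter> (pverts T - {y}) = {}"
      using disj by (auto simp: deg_verts_def)
    moreover have "x \<in> deg_verts 2 G" "finite (deg_verts 2 G)"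
      using x degx G(1) by (auto simp: deg_verts_def)
    ultimately show ?thesis
      using T(1,2) y card_gt_0_iff[of "deg_verts 2 G"] by (auto simp: card_Un_disjoint)
  qed
  moreover have "card (deg_verts 3 ?H) = card (deg_verts 3 G) + 2"
  proof -
    have "deg_verts 3 ?H = deg_verts 3 G \<union> {x, y}"
      unfolding degs using degx x y by (auto simp: deg_verts_def)
    moreover have "deg_verts 3 G \<inter> {x, y} = {}"
      using disj degx y by (auto simp: deg_verts_def)
    moreover have "x \<noteq> y" "finite (deg_verts 3 G)"
      using x y disj G(1) by (auto simp: deg_verts_def)
    ultimately show ?thesis
      by (auto simp: card_Un_disjoint)
  qed
  moreover have "independence_number ?H = independence_number G + 1"
  proof -
    obtain I where I: "independent_set G I" "card I = independence_number G"
      using ex_independent_set_max[OF G(1)] .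
    \<comment> \<open>A triangle vertex \<open>z\<close> other than \<open>y\<close> has no
      neighbour in \<open>G\<close>, so it extends any independent set of \<open>G\<close>.\<close>
    have "card (pverts T - {y}) = 2"
      using T y by simp
    then obtain z where z: "z \<in> pverts T" "z \<noteq> y"
      by (metis Diff_iff all_not_in_conv card.empty singletonI zero_neq_numeral)
    show ?thesis
    proof (rule independence_number_eqI)
      show "finite (pverts ?H)"
        using G(1) T(1) by simp
      have IG: "I \<subseteq> pverts G" "z \<notin> pverts G"
        using I(1) z disj by (auto simp: independent_set_def)
      show "independent_set ?H (insert z I)"
        using I(1) z x y IG disj G(2) unfolding independent_set_def arcs_H by auto
      show "card (insert z I) = independence_number G + 1"
        using I(2) IG finite_subset[OF IG(1) G(1)] by (auto simp: card_insert_if)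
      fix S assume S: "independent_set ?H S"
      have "S = (S \<inter> pverts G) \<union> (S \<inter> pverts T)"
        using S by (auto simp: independent_set_def)
      then have "card S \<le> card (S \<inter> pverts G) + card (S \<inter> pverts T)"
        using card_Un_le by metis
      moreover have "independent_set G (S \<inter> pverts G)"
        using S by (auto simp: independent_set_def)
      then have "card (S \<inter> pverts G) \<le> independence_number G"
        using card_le_independence_number[OF G(1)] by blast
      moreover have "card (S \<inter> pverts T) \<le> 1"
        using S T(1) unfolding independent_set_def arcs_H by (auto simp: card_le_Suc0_iff_eq)
      ultimately show "card S \<le> independence_number G + 1"
        by linarith
    qed
  qed
  moreover have "parcs ?H \<subseteq> pverts ?H \<times> pverts ?H"
    using G(2) x y by (auto simp: T(3))
  ultimately show ?case
    using G(1,3) T(1) by simp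
qed

theorem theorem8:
  fixes c1 :: real
  assumes "5/7 \<le> c1" and "c1 \<le> 1"
  shows "(\<forall>G \<in> (class_G :: 'a ugraph set).
            real (independence_number G) \<ge>
              c1 * real (card (deg_verts 1 G)) + 3/7 * real (card (deg_verts 2 G))
              + (1 - c1) * real (card (deg_verts 3 G)) - (2 * c1 - 8/7)) \<and>
         (\<forall>G \<in> (class_B :: 'a ugraph set).
            real (independence_number G) =
              c1 * real (card (deg_verts 1 G)) + 3/7 * real (card (deg_verts 2 G))
              + (1 - c1) * real (card (deg_verts 3 G)) - (2 * c1 - 8/7)) \<and>
         (c1 = 5/7 \<longrightarrow> (\<forall>G \<in> (class_A :: 'a ugraph set).
            real (independence_number G) =
              c1 * real (card (deg_verts 1 G)) + 3/7 * real (card (deg_verts 2 G))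
              + (1 - c1) * real (card (deg_verts 3 G)) - (2 * c1 - 8/7)))"
proof (intro conjI ballI impI)
  fix G :: "'a ugraph"
  assume "G \<in> class_G"
  then show "real (independence_number G) \<ge>
      c1 * real (card (deg_verts 1 G)) + 3/7 * real (card (deg_verts 2 G))
      + (1 - c1) * real (card (deg_verts 3 G)) - (2 * c1 - 8/7)"
    using class_G_bound[OF assms(1)] by blast
next
  fix G :: "'a ugraph"
  assume "G \<in> class_B"
  then obtain n where "2 \<le> n" "independence_number G = n" "card (deg_verts 1 G) = n"
    "card (deg_verts 2 G) = 2" "card (deg_verts 3 G) = n - 2"
    by (rule class_B_counts)
  \<comment> \<open>The coefficient of \<open>n\<close> is \<open>c1 + (1 - c1) = 1\<close>, and the
    constants \<open>6/7 - 2 * (1 - c1) - (2 * c1 - 8/7)\<close> cancel.\<close>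
  then show "real (independence_number G) =
      c1 * real (card (deg_verts 1 G)) + 3/7 * real (card (deg_verts 2 G))
      + (1 - c1) * real (card (deg_verts 3 G)) - (2 * c1 - 8/7)"
    by (simp add: of_nat_diff algebra_simps)
next
  fix G :: "'a ugraph"
  assume "c1 = 5/7" "G \<in> class_A"
  from class_A_counts[OF this(2)]
  have "7 * real (independence_number G) + 2 = 5 * real (card (deg_verts 1 G))
      + 3 * real (card (deg_verts 2 G)) + 2 * real (card (deg_verts 3 G))"
    by linarith
  then show "real (independence_number G) =
      c1 * real (card (deg_verts 1 G)) + 3/7 * real (card (deg_verts 2 G))
      + (1 - c1) * real (card (deg_verts 3 G)) - (2 * c1 - 8/7)"
    unfolding \<open>c1 = 5/7\<close> by simp
qed

end
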